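(* Let $(M,\mathrm{dist})$ be any metric space, $P\subset M$ a set of $n$ points, $k\le n$ a positive integer and $B$ the block size. There exists an indexing scheme for $P$ using $n\lceil k/B\rceil$ blocks of space such that for every query $q\in M$, some $\lceil k/B\rceil$ blocks together contain a set of $k$ points of $P$ each at distance at most $3\,\mathrm{dist}(q,p^k_q)$ from $q$, where $p^k_q$ is the $k$-th nearest neighbor of $q$ in $P$; i.e. it returns $3$-approximate $k$ nearest neighbors in $\lceil k/B\rceil$ I/Os.
   Context: Indexing scheme (indexability model): for a point set $P$ and block size $B$, an indexing scheme is a collection $\mathcal{B}$ of blocks, each a subset of $P$ of at most $B$ points; its space usage is $|\mathcal{B}|$. The query time for a query $q$ is the minimum number of blocks whose union contains a valid answer to $q$; the blocks are assumed to be identified for free (by an oracle). *)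

theory Defs
  imports "HOL-Analysis.Abstract_Metric_Spaces" "HOL-Library.Multiset" "HOL-Library.Extended_Nat"
begin

text \<open>Blocks form a multiset, so a point set stored twice counts twice towards the space usage.\<close>

definition indexing_scheme :: "'a set \<Rightarrow> nat \<Rightarrow> 'a set multiset \<Rightarrow> bool" where
  "indexing_scheme P B \<B> \<longleftrightarrow> (\<forall>b \<in># \<B>. b \<subseteq> P \<and> finite b \<and> card b \<le> B)"

text \<open>A query is represented by the predicate \<^term>\<open>valid\<close> singling out its valid answers.\<close>

definition answered_by :: "('a set \<Rightarrow> bool) \<Rightarrow> 'a set multiset \<Rightarrow> bool" where
  "answered_by valid \<S> \<longleftrightarrow> (\<exists>A. A \<subseteq> \<Union>(set_mset \<S>) \<and> valid A)"

text \<open>The value is \<^term>\<open>\<infinity>\<close> if no subcollection of the blocks contains a valid answer.\<close>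

definition query_time :: "'a set multiset \<Rightarrow> ('a set \<Rightarrow> bool) \<Rightarrow> enat" where
  "query_time \<B> valid = Inf {enat (size \<S>) | \<S>. \<S> \<subseteq># \<B> \<and> answered_by valid \<S>}"

definition nn_order :: "('a \<Rightarrow> 'a \<Rightarrow> real) \<Rightarrow> 'a set \<Rightarrow> 'a \<Rightarrow> 'a list \<Rightarrow> bool" where
  "nn_order d P q xs \<longleftrightarrow>
     distinct xs \<and> set xs = P \<and> sorted_wrt (\<lambda>x y. d q x \<le> d q y) xs"

text \<open>A relation rather than a function, since ties may be broken in any way; the distance
  of the \<^term>\<open>k\<close>-th nearest neighbor does not depend on the choice.\<close>

definition kth_nn :: "('a \<Rightarrow> 'a \<Rightarrow> real) \<Rightarrow> 'a set \<Rightarrow> 'a \<Rightarrow> nat \<Rightarrow> 'a \<Rightarrow> bool" where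
  "kth_nn d P q k p \<longleftrightarrow>
     (\<exists>xs. nn_order d P q xs \<and> 1 \<le> k \<and> k \<le> length xs \<and> p = xs ! (k - 1))"

lemma kth_nn_exists:
  assumes "finite P" "1 \<le> k" "k \<le> card P"
  shows "\<exists>p. kth_nn d P q k p"
proof -
  obtain ys where ys: "set ys = P" "distinct ys"
    using assms(1) finite_distinct_list by blast
  have "sorted_wrt (\<lambda>x y. d q x \<le> d q y) (sort_key (d q) ys)"
    using sorted_sort_key[of "d q" ys] by (simp only: sorted_wrt_map)
  then have "nn_order d P q (sort_key (d q) ys)"
    using ys by (simp add: nn_order_def)
  moreover have "length (sort_key (d q) ys) = card P"
    using ys distinct_card by fastforce
  ultimately show ?thesis
    unfolding kth_nn_def using assms by metis
qed

lemma kth_nn_dist_unique: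
  assumes "kth_nn d P q k p" "kth_nn d P q k p'"
  shows "d q p = d q p'"
proof -
  obtain xs ys where xs: "nn_order d P q xs" "1 \<le> k" "k \<le> length xs" "p = xs ! (k - 1)"
    and ys: "nn_order d P q ys" "k \<le> length ys" "p' = ys ! (k - 1)"
    using assms unfolding kth_nn_def by blast
  have "mset xs = mset ys"
    using xs(1) ys(1) by (metis nn_order_def set_eq_iff_mset_eq_distinct)
  then have "mset (map (d q) xs) = mset (map (d q) ys)"
    by simp
  moreover have "sorted (map (d q) xs)" "sorted (map (d q) ys)"
    using xs(1) ys(1) by (simp_all add: nn_order_def sorted_wrt_map)
  ultimately have "map (d q) xs = map (d q) ys"
    by (metis properties_for_sort)
  moreover have "d q p = map (d q) xs ! (k - 1)" "d q p' = map (d q) ys ! (k - 1)"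
    using xs ys by simp_all
  ultimately show ?thesis by simp
qed

definition approx_knn ::
  "('a \<Rightarrow> 'a \<Rightarrow> real) \<Rightarrow> 'a set \<Rightarrow> real \<Rightarrow> nat \<Rightarrow> 'a \<Rightarrow> 'a set \<Rightarrow> bool" where
  "approx_knn d P c k q A \<longleftrightarrow>
     A \<subseteq> P \<and> finite A \<and> card A = k \<and>
     (\<forall>p. kth_nn d P q k p \<longrightarrow> (\<forall>a\<in>A. d q a \<le> c * d q p))"

end

theory Submission
  imports Defs
begin

text \<open>For every point \<open>p\<close> of \<open>P\<close>, store its \<open>k\<close> nearest neighbours in \<open>\<lceil>k/B\<rceil>\<close> blocks, and answer a
  query \<open>q\<close> with the blocks of its nearest neighbour \<open>p\<close>. If \<open>r\<close> is the distance from \<open>q\<close> to its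
  \<open>k\<close>-th neighbour, the \<open>k\<close> nearest neighbours of \<open>q\<close> are within \<open>2r\<close> of \<open>p\<close>. Hence so are the
  \<open>k\<close> nearest neighbours of \<open>p\<close>, which are therefore within \<open>3r\<close> of \<open>q\<close>.\<close>

lemma nn_order_exists:
  assumes "finite P"
  shows "\<exists>xs. nn_order d P q xs"
proof -
  obtain ys where ys: "set ys = P" "distinct ys"
    using assms finite_distinct_list by blast
  have "sorted_wrt (\<lambda>x y. d q x \<le> d q y) (sort_key (d q) ys)"
    using sorted_sort_key[of "d q" ys] by (simp only: sorted_wrt_map)
  then have "nn_order d P q (sort_key (d q) ys)"
    using ys by (simp add: nn_order_def)
  then show ?thesis ..
qed

lemma nn_order_length: "nn_order d P q xs \<Longrightarrow> length xs = card P"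
  by (auto simp: nn_order_def distinct_card)

lemma nn_order_nth_mono:
  assumes "nn_order d P q xs" "i \<le> j" "j < length xs"
  shows "d q (xs ! i) \<le> d q (xs ! j)"
proof (cases "i = j")
  case False
  then show ?thesis
    using assms sorted_wrt_nth_less[of "\<lambda>x y. d q x \<le> d q y" xs i j] by (simp add: nn_order_def)
qed simp

text \<open>The first \<open>k - 1\<close> entries are too few to cover \<open>A\<close>, so some
  point of \<open>A\<close> sits at index \<open>k - 1\<close> or later. That point is at least as
  far from \<open>q\<close> as each of the first \<open>k\<close> entries.\<close>

lemma nn_order_take_le:
  assumes ord: "nn_order d P q xs" and A: "A \<subseteq> P" "card A = k"
    and le: "\<And>a. a \<in> A \<Longrightarrow> d q a \<le> r" and x: "x \<in> set (take k xs)"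
  shows "d q x \<le> r"
proof -
  obtain i where i: "i < k" "i < length xs" "x = xs ! i"
    using x by (auto simp: in_set_conv_nth)
  \<comment> \<open>Strict because \<open>i < k\<close> forces \<open>k > 0\<close>.\<close>
  have "card (set (take (k - 1) xs)) < card A"
    using card_length[of "take (k - 1) xs"] i A by simp linarith
  then obtain a where a: "a \<in> A" "a \<notin> set (take (k - 1) xs)"
    by (metis List.finite_set card_mono leD subsetI)
  then obtain j where j: "j < length xs" "a = xs ! j"
    using A ord by (metis in_set_conv_nth nn_order_def subsetD)
  have "k - 1 \<le> j"
  proof (rule ccontr)
    assume "\<not> k - 1 \<le> j"
    then have "a \<in> set (take (k - 1) xs)"
      using j by (auto simp: in_set_conv_nth intro!: exI[of _ j])
    then show False using a(2) by simp
  qed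
  then have "d q x \<le> d q a"
    using nn_order_nth_mono[OF ord, of i j] i j by simp
  then show ?thesis using le[OF a(1)] by simp
qed

text \<open>The number \<open>m\<close> is prescribed rather than derived from the list: chunks past
  its end are empty but still count, which makes the size exactly \<open>m\<close>.\<close>

definition chunks :: "nat \<Rightarrow> nat \<Rightarrow> 'a list \<Rightarrow> 'a set multiset" where
  "chunks B m xs = mset (map (\<lambda>i. set (take B (drop (i * B) xs))) [0..<m])"

lemma size_chunks [simp]: "size (chunks B m xs) = m"
  by (simp add: chunks_def)

lemma indexing_scheme_chunks:
  assumes "set xs \<subseteq> P"
  shows "indexing_scheme P B (chunks B m xs)"
proof -
  have "set (take B (drop i xs)) \<subseteq> P" for i
    using assms set_take_subset[of B "drop i xs"] set_drop_subset[of i xs] by blast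
  moreover have "card (set (take B (drop i xs))) \<le> B" for i
    using card_length[of "take B (drop i xs)"] by simp
  ultimately show ?thesis
    by (auto simp: indexing_scheme_def chunks_def)
qed

text \<open>The entry at index \<open>j\<close> lies in chunk \<open>j div B\<close>, at offset
  \<open>j mod B\<close>.\<close>

lemma set_subset_Union_chunks:
  assumes "length xs \<le> m * B"
  shows "set xs \<subseteq> \<Union>(set_mset (chunks B m xs))"
proof
  fix x assume "x \<in> set xs"
  then obtain j where j: "j < length xs" "x = xs ! j"
    by (auto simp: in_set_conv_nth)
  have B: "B > 0" and m: "j div B < m"
    using j assms by (auto simp: less_mult_imp_div_less intro: Nat.gr0I)
  have split: "j div B * B + j mod B = j" by (rule div_mult_mod_eq)
  then have "j div B * B \<le> length xs" using j by linarith
  then have "take B (drop (j div B * B) xs) ! (j mod B) = x"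
    using j B split by (simp only: nth_take nth_drop mod_less_divisor)
  moreover have "j mod B < length (take B (drop (j div B * B) xs))"
  proof -
    have "j mod B < length xs - j div B * B" using j split by linarith
    then show ?thesis using B by (simp only: length_take length_drop min_less_iff_conj mod_less_divisor)
  qed
  ultimately have "x \<in> set (take B (drop (j div B * B) xs))"
    by (metis nth_mem)
  then show "x \<in> \<Union>(set_mset (chunks B m xs))"
    using m by (auto simp: chunks_def)
qed

lemma (in Metric_space) approx_knn_of_nearest:
  assumes "P \<subseteq> M" "q \<in> M" and xs: "nn_order d P q xs" and ys: "nn_order d P (xs ! 0) ys"
    and k: "1 \<le> k" "k \<le> card P"
  shows "approx_knn d P 3 k q (set (take k ys))"
  unfolding approx_knn_def
proof (intro conjI allI impI ballI)
  let ?p = "xs ! 0" and ?r = "d q (xs ! (k - 1))"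
  have len: "length xs = card P" "length ys = card P"
    using nn_order_length[OF xs] nn_order_length[OF ys] .
  have set: "set xs = P" "set ys = P" "distinct xs" "distinct ys"
    using xs ys by (auto simp: nn_order_def)
  show "set (take k ys) \<subseteq> P"
    using set set_take_subset by metis
  show "card (set (take k ys)) = k"
    using set len k by (simp add: distinct_card)
  fix p a assume p: "kth_nn d P q k p" and a: "a \<in> set (take k ys)"
  \<comment> \<open>With ties, \<open>p\<close> may differ from the \<open>k\<close>-th entry of
    \<open>xs\<close>; only their distances to \<open>q\<close> must agree.\<close>
  have "kth_nn d P q k (xs ! (k - 1))"
    using xs k len by (auto simp: kth_nn_def)
  then have r: "d q p = ?r"
    by (rule kth_nn_dist_unique[OF p])
  have "?p \<in> set xs" using len k by (intro nth_mem) simp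
  then have pM: "?p \<in> M" using set assms(1) by blast
  have aM: "a \<in> M" using a set assms(1) by (auto dest: in_set_takeD)
  have near: "d q (xs ! i) \<le> ?r" if "i < k" for i
    using nn_order_nth_mono[OF xs, of i "k - 1"] that k len by simp
  \<comment> \<open>Detour through \<open>q\<close>: both \<open>?p\<close> and \<open>b\<close> are
    among the first \<open>k\<close> entries of \<open>xs\<close>, hence within \<open>?r\<close> of
    \<open>q\<close>.\<close>
  have "d ?p b \<le> 2 * ?r" if b: "b \<in> set (take k xs)" for b
  proof -
    obtain i where i: "i < k" "i < length xs" "b = xs ! i"
      using b by (auto simp: in_set_conv_nth)
    then have "b \<in> M" using set assms(1) by auto
    then have "d ?p b \<le> d q ?p + d q b"
      using triangle[of ?p q b] pM assms(2) by (simp add: commute)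
    then show ?thesis using near[of 0] near[of i] i k by simp
  qed
  \<comment> \<open>The first \<open>k\<close> entries of \<open>xs\<close> serve as the comparison
    set \<open>A\<close> for the ordering \<open>ys\<close> around \<open>?p\<close>.\<close>
  then have "d ?p a \<le> 2 * ?r"
    using nn_order_take_le[OF ys, of "set (take k xs)" k] a set len k set_take_subset[of k xs]
    by (simp add: distinct_card)
  then show "d q a \<le> 3 * d q p"
    using triangle[of q ?p a] pM aM assms(2) near[of 0] k r by simp
qed simp

lemma query_time_le:
  assumes "\<S> \<subseteq># \<B>" "answered_by valid \<S>"
  shows "query_time \<B> valid \<le> enat (size \<S>)"
  unfolding query_time_def by (rule Inf_lower) (use assms in blast)

theorem theorem2:
  fixes M P :: "'a set" and d :: "'a \<Rightarrow> 'a \<Rightarrow> real" and n k B :: nat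
  assumes "Metric_space M d"
    and "P \<subseteq> M" and "finite P" and "card P = n"
    and "1 \<le> k" and "k \<le> n" and "1 \<le> B"
  shows "\<exists>\<B>. indexing_scheme P B \<B> \<and> size \<B> = n * nat \<lceil>real k / real B\<rceil> \<and>
           (\<forall>q\<in>M.
              (\<exists>\<S>. \<S> \<subseteq># \<B> \<and> size \<S> = nat \<lceil>real k / real B\<rceil> \<and>
                   answered_by (approx_knn d P 3 k q) \<S>) \<and>
              query_time \<B> (approx_knn d P 3 k q) \<le> enat (nat \<lceil>real k / real B\<rceil>))"
proof -
  interpret Metric_space M d by fact
  define m where "m = nat \<lceil>real k / real B\<rceil>"
  have "real k / real B \<le> real m"
    unfolding m_def by (rule real_nat_ceiling_ge)
  then have "real k \<le> real (m * B)"
    using assms(7) by (simp add: field_simps)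
  then have mB: "k \<le> m * B" by linarith
  \<comment> \<open>Orderings are fixed before any query, so the blocks do not depend on
    \<open>q\<close>.\<close>
  obtain ord where ord: "\<And>p. nn_order d P p (ord p)"
    using nn_order_exists[OF assms(3)] by metis
  define F where "F p = chunks B m (take k (ord p))" for p
  \<comment> \<open>The multiset sum keeps blocks shared by several points with multiplicity, so the
    size is exactly \<open>n * m\<close>.\<close>
  define \<B> where "\<B> = (\<Sum>p\<in>P. F p)"
  have "indexing_scheme P B (F p)" for p
    unfolding F_def using ord[of p]
    by (intro indexing_scheme_chunks) (metis nn_order_def set_take_subset)
  then have scheme: "indexing_scheme P B \<B>"
    using assms(3) by (auto simp: indexing_scheme_def \<B>_def set_mset_sum)
  have size: "size \<B> = n * m"
    by (simp add: \<B>_def F_def assms)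
  have "\<exists>\<S>. \<S> \<subseteq># \<B> \<and> size \<S> = m \<and> answered_by (approx_knn d P 3 k q) \<S>"
    if q: "q \<in> M" for q
  proof -
    define p where "p = ord q ! 0"
    \<comment> \<open>Since \<open>1 \<le> k \<le> n\<close>, the list \<open>ord q\<close> is
      nonempty and index 0 is a genuine entry.\<close>
    have "p \<in> P"
      using ord[of q] assms nn_order_length[OF ord[of q]]
      unfolding p_def by (auto simp: nn_order_def)
    then have "F p \<subseteq># \<B>"
      using sum.remove[OF assms(3), of p F] by (simp add: \<B>_def)
    moreover have "size (F p) = m"
      by (simp add: F_def)
    moreover have "approx_knn d P 3 k q (set (take k (ord p)))"
      using approx_knn_of_nearest[OF assms(2) q ord, of "ord p" k] ord assms p_def by simp
    moreover have "set (take k (ord p)) \<subseteq> \<Union>(set_mset (F p))"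
      unfolding F_def using mB by (intro set_subset_Union_chunks) simp
    ultimately show ?thesis
      unfolding answered_by_def by blast
  qed
  then show ?thesis
    unfolding m_def[symmetric] using scheme size query_time_le by (metis (no_types))
qed

end
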